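(* Let $(\mathbb{X},\|\cdot\|_{\mathbb{X}})$ be a real normed space and let $f:\mathbb{X}\to\mathbb{R}$ be a proper function. Assume that $f$ has a finite directional derivative, a finite Clarke directional derivative and a finite subderivative at $\overline{x}\in\mathbb{X}$ in every direction $x-\overline{x}$ with arbitrary $x\in\mathbb{X}$. Then $f$ is radially epidifferentiable at $\overline{x}$ and $$f^r(\overline{x};x-\overline{x})=\mathrm{d}f(\overline{x};x-\overline{x})=f'(\overline{x};x-\overline{x})=f^{\circ}(\overline{x};x-\overline{x})\quad\text{for all } x\in\mathbb{X}$$ if and only if $$f(x)-f(\overline{x})\ge f^{\circ}(\overline{x};x-\overline{x})\quad\text{for all } x\in\mathbb{X}.$$
   Context: For $h\in\mathbb{X}$: the directional derivative is $f'(\overline{x};h)=\lim_{t\downarrow 0}\frac{f(\overline{x}+th)-f(\overline{x})}{t}$ (if the limit exists). The Clarke directional derivative is $f^{\circ}(\overline{x};h)=\limsup_{t\downarrow 0,\ y\to\overline{x}}\frac{f(y+th)-f(y)}{t}$ (the paper introduces it for locally Lipschitz functions on a Banach space). The (Rockafellar) subderivative is $\mathrm{d}f(\overline{x};h)=\liminf_{t\downarrow 0,\ u\to h}\frac{f(\overline{x}+tu)-f(\overline{x})}{t}$. For a nonempty subset $A$ of a real normed space and $a\in A$, the closed radial cone is $R(A;a)=\mathrm{cl}(\mathrm{cone}(A-a))$, i.e. the set of all $w$ for which there are $\lambda_n>0$ and $a_n\in A$ with $\lim_{n\to\infty}\lambda_n(a_n-a)=w$. The epigraph of $f$ is $\mathrm{epi}\,f=\{(x,y)\in\mathbb{X}\times\mathbb{R}: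 f(x)\le y\}$. The radial epiderivative $f^r(\overline{x};\cdot)$ is the function defined by $\mathrm{epi}\,f^r(\overline{x};\cdot)=R(\mathrm{epi}\,f;(\overline{x},f(\overline{x})))$; thus $f^r(\overline{x};h)=\inf\{y\in\mathbb{R}:(h,y)\in R(\mathrm{epi}\,f;(\overline{x},f(\overline{x})))\}$. The function $f$ is called radially epidifferentiable at $\overline{x}$ if $f^r(\overline{x};h)$ exists and is finite for every $h\in\mathbb{X}$.
   Formalization: The function f is additionally assumed Lipschitz on a neighbourhood of x̄, the setting in which the Clarke derivative is introduced; without it the claim fails, e.g. for f = max(φ,0) with φ a discontinuous linear functional and x̄ = 0. *)

theory Defs
  imports "HOL-Analysis.Analysis"
begin

text \<open>
  All derivatives take values in the extended reals, so that being finite is a condition and not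
  a consequence of the typing.
\<close>

definition diff_quotient :: "('a::real_vector \<Rightarrow> real) \<Rightarrow> 'a \<Rightarrow> 'a \<Rightarrow> real \<Rightarrow> ereal" where
  "diff_quotient f x h t = ereal ((f (x + t *\<^sub>R h) - f x) / t)"

definition has_dir_deriv :: "('a::real_normed_vector \<Rightarrow> real) \<Rightarrow> 'a \<Rightarrow> 'a \<Rightarrow> ereal \<Rightarrow> bool" where
  "has_dir_deriv f x h d \<longleftrightarrow> (diff_quotient f x h \<longlongrightarrow> d) (at_right 0)"

text \<open>Meaningful only if the limit exists, that is, if \<open>has_dir_deriv f x h d\<close> for some \<open>d\<close>.\<close>

definition dir_deriv :: "('a::real_normed_vector \<Rightarrow> real) \<Rightarrow> 'a \<Rightarrow> 'a \<Rightarrow> ereal" where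
  "dir_deriv f x h = Lim (at_right 0) (diff_quotient f x h)"

text \<open>
  In the next two definitions the moving point may coincide with its limit: the second factor of
  the filter is \<open>nhds\<close>, not \<open>at\<close>.
\<close>

definition clarke_deriv :: "('a::real_normed_vector \<Rightarrow> real) \<Rightarrow> 'a \<Rightarrow> 'a \<Rightarrow> ereal" where
  "clarke_deriv f x h = Limsup (at_right 0 \<times>\<^sub>F nhds x) (\<lambda>(t, y). diff_quotient f y h t)"

definition subderiv :: "('a::real_normed_vector \<Rightarrow> real) \<Rightarrow> 'a \<Rightarrow> 'a \<Rightarrow> ereal" where
  "subderiv f x h = Liminf (at_right 0 \<times>\<^sub>F nhds h) (\<lambda>(t, u). diff_quotient f x u t)"

definition radial_cone :: "'a::real_normed_vector set \<Rightarrow> 'a \<Rightarrow> 'a set" where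
  "radial_cone A a = closure (cone hull ((\<lambda>x. x - a) ` A))"

definition radial_epideriv :: "('a::real_normed_vector \<Rightarrow> real) \<Rightarrow> 'a \<Rightarrow> 'a \<Rightarrow> ereal" where
  "radial_epideriv f x h = (INF y\<in>{y. (h, y) \<in> radial_cone (epigraph UNIV f) (x, f x)}. ereal y)"

text \<open>
  The infimum always exists in the extended reals; it is \<open>\<infinity>\<close> if no \<open>(h, y)\<close> lies in the radial
  cone. The lemma \<open>radial_epideriv_le_iff\<close> below shows that it does have the radial cone as its
  epigraph.
\<close>

definition radially_epidifferentiable :: "('a::real_normed_vector \<Rightarrow> real) \<Rightarrow> 'a \<Rightarrow> bool" where
  "radially_epidifferentiable f x \<longleftrightarrow> (\<forall>h. \<bar>radial_epideriv f x h\<bar> \<noteq> \<infinity>)"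

lemma radial_cone_sequential:
  assumes "a \<in> A"
  shows "w \<in> radial_cone A a \<longleftrightarrow>
    (\<exists>l b. (\<forall>n::nat. l n > 0 \<and> b n \<in> A) \<and> (\<lambda>n. l n *\<^sub>R (b n - a)) \<longlonglongrightarrow> w)"
proof
  assume "w \<in> radial_cone A a"
  then obtain z where z: "\<And>n. z n \<in> cone hull ((\<lambda>x. x - a) ` A)" "z \<longlonglongrightarrow> w"
    unfolding radial_cone_def closure_sequential by blast
  have "\<exists>c b. c > 0 \<and> b \<in> A \<and> z n = c *\<^sub>R (b - a)" for n :: nat
  proof -
    obtain c b where cb: "c \<ge> 0" "b \<in> A" "z n = c *\<^sub>R (b - a)"
      using z(1)[of n] unfolding cone_hull_expl by blast
    show ?thesis
    proof (cases "c = 0")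
      case True
      then have "z n = 1 *\<^sub>R (a - a)" using cb by simp
      then show ?thesis using assms zero_less_one by blast
    next
      case False
      then have "c > 0" using cb by simp
      then show ?thesis using cb by blast
    qed
  qed
  then obtain l b where lb: "\<And>n. l n > 0 \<and> b n \<in> A \<and> z n = l n *\<^sub>R (b n - a)"
    by metis
  then have "z = (\<lambda>n. l n *\<^sub>R (b n - a))" by blast
  with lb z(2) show "\<exists>l b. (\<forall>n::nat. l n > 0 \<and> b n \<in> A) \<and> (\<lambda>n. l n *\<^sub>R (b n - a)) \<longlonglongrightarrow> w"
    by blast
next
  assume "\<exists>l b. (\<forall>n::nat. l n > 0 \<and> b n \<in> A) \<and> (\<lambda>n. l n *\<^sub>R (b n - a)) \<longlonglongrightarrow> w"
  then obtain l b where lb: "\<And>n::nat. l n > 0 \<and> b n \<in> A" "(\<lambda>n. l n *\<^sub>R (b n - a)) \<longlonglongrightarrow> w"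
    by blast
  have "l n *\<^sub>R (b n - a) \<in> cone hull ((\<lambda>x. x - a) ` A)" for n
    unfolding cone_hull_expl using lb(1)[of n] by (auto intro: less_imp_le)
  with lb(2) show "w \<in> radial_cone A a"
    unfolding radial_cone_def closure_sequential by (intro exI[of _ "\<lambda>n. l n *\<^sub>R (b n - a)"]) blast
qed

lemma radial_cone_epigraph_upward:
  assumes "(h, y) \<in> radial_cone (epigraph UNIV f) (x, f x)" "y \<le> y'"
  shows "(h, y') \<in> radial_cone (epigraph UNIV f) (x, f x)"
proof -
  have x: "(x, f x) \<in> epigraph UNIV f" by (simp add: mem_epigraph)
  obtain l b where lb: "\<And>n::nat. l n > 0 \<and> b n \<in> epigraph UNIV f"
      "(\<lambda>n. l n *\<^sub>R (b n - (x, f x))) \<longlonglongrightarrow> (h, y)"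
    using assms(1) unfolding radial_cone_sequential[OF x] by blast
  define b' where "b' n = (fst (b n), snd (b n) + (y' - y) / l n)" for n
  have "b' n \<in> epigraph UNIV f" for n
    using lb(1)[of n] assms(2) unfolding b'_def epigraph_def
    by (auto intro: add_increasing2)
  moreover have "l n *\<^sub>R (b' n - (x, f x)) = l n *\<^sub>R (b n - (x, f x)) + (0, y' - y)" for n
    using lb(1)[of n] by (auto simp: b'_def prod_eq_iff algebra_simps diff_divide_distrib)
  moreover have "(\<lambda>n. l n *\<^sub>R (b n - (x, f x)) + (0, y' - y)) \<longlonglongrightarrow> (h, y')"
    using tendsto_add[OF lb(2) tendsto_const[of "(0, y' - y)"]] by simp
  ultimately show ?thesis
    unfolding radial_cone_sequential[OF x] using lb(1)
    by (intro exI[of _ l] exI[of _ b']) simp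
qed

lemma radial_epideriv_le_iff:
  "radial_epideriv f x h \<le> ereal y \<longleftrightarrow> (h, y) \<in> radial_cone (epigraph UNIV f) (x, f x)"
proof
  assume "(h, y) \<in> radial_cone (epigraph UNIV f) (x, f x)"
  then show "radial_epideriv f x h \<le> ereal y"
    unfolding radial_epideriv_def by (auto intro: INF_lower)
next
  assume le: "radial_epideriv f x h \<le> ereal y"
  have step: "(h, y + e) \<in> radial_cone (epigraph UNIV f) (x, f x)" if "e > 0" for e
  proof -
    have "radial_epideriv f x h < ereal (y + e)"
      using le that by (intro le_less_trans[OF le]) simp
    then obtain z where "(h, z) \<in> radial_cone (epigraph UNIV f) (x, f x)" "z < y + e"
      unfolding radial_epideriv_def INF_less_iff by auto
    then show ?thesis using radial_cone_epigraph_upward less_imp_le by blast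
  qed
  have "(\<lambda>n. (h, y + inverse (real (Suc n)))) \<longlonglongrightarrow> (h, y + 0)"
    by (intro tendsto_intros LIMSEQ_inverse_real_of_nat)
  moreover have "closed (radial_cone (epigraph UNIV f) (x, f x))"
    by (simp add: radial_cone_def)
  ultimately have "(h, y + 0) \<in> radial_cone (epigraph UNIV f) (x, f x)"
    by (rule closed_sequentially[rotated 2]) (simp add: step)
  then show "(h, y) \<in> radial_cone (epigraph UNIV f) (x, f x)" by simp
qed

end

theory Submission
  imports Defs
begin

text \<open>
  Since \<open>f\<close> is Lipschitz near \<open>xbar\<close>, the subderivative always coincides with the directional
  derivative, which in turn is at most the Clarke derivative. The cone generated by the epigraph
  contains the point \<open>(h, f (xbar + h) - f xbar)\<close> and all points \<open>(h, (f (xbar + t h) - f xbar) / t)\<close>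
  with \<open>t > 0\<close>, so the radial epiderivative at \<open>h\<close> is at most \<open>f (xbar + h) - f xbar\<close> and at most
  the directional derivative. The former bound gives one implication. For the other, the assumed
  inequality at \<open>xbar + t h\<close> and positive homogeneity of the Clarke derivative show that it equals
  the directional derivative \<open>D\<close>. Now \<open>D\<close> is positively homogeneous and Lipschitz, so the
  inequality \<open>D v \<le> f (xbar + v) - f xbar\<close> passes to the closed cone generated by the epigraph,
  which makes \<open>D\<close> a lower bound of the radial epiderivative.
\<close>

lemma nontrivial_at_right_times_nhds:
  "(at_right (0::real) \<times>\<^sub>F nhds (h::'a::topological_space)) \<noteq> bot"
  by (simp add: prod_filter_eq_bot)

lemma dir_deriv_eq: "has_dir_deriv f x h d \<Longrightarrow> dir_deriv f x h = d"
  unfolding has_dir_deriv_def dir_deriv_def by (rule tendsto_Lim) simp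

text \<open>The quotient at step \<open>t\<close> in direction \<open>c *\<^sub>R h\<close> is
  \<open>c\<close> times the quotient at step \<open>c * t\<close> in direction \<open>h\<close>,
  and the rescaling of steps by \<open>c\<close> maps \<open>at_right 0\<close> onto itself.\<close>

lemma clarke_deriv_scaleR:
  assumes "c > 0"
  shows "clarke_deriv f x (c *\<^sub>R h) = ereal c * clarke_deriv f x h"
proof -
  let ?F = "at_right (0::real) \<times>\<^sub>F nhds x"
  let ?g = "\<lambda>(t, y). diff_quotient f y h t"
  have F: "filtermap (apfst ((*) c)) ?F = ?F"
    using filtermap_times_pos_at_right[OF assms, of 0]
    by (simp flip: prod_filtermap1)
  have inj: "inj (apfst ((*) c) :: real \<times> 'a \<Rightarrow> _)"
    using assms by (auto intro!: injI)
  have "clarke_deriv f x (c *\<^sub>R h) = Limsup ?F (\<lambda>p. ereal c * ?g (apfst ((*) c) p))"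
    unfolding clarke_deriv_def using assms
    by (intro arg_cong2[of _ _ _ _ Limsup])
      (auto simp: fun_eq_iff diff_quotient_def mult.commute)
  also have "\<dots> = ereal c * Limsup ?F (\<lambda>p. ?g (apfst ((*) c) p))"
    using assms by (intro Limsup_ereal_mult_left nontrivial_at_right_times_nhds) simp
  also have "Limsup ?F (\<lambda>p. ?g (apfst ((*) c) p)) = Limsup ?F ?g"
    by (subst Limsup_filtermap_eq[OF inj, symmetric]) (simp add: F)
  finally show ?thesis by (simp add: clarke_deriv_def)
qed

text \<open>Freezing the base point at \<open>y = x\<close> can only lower the limsup. This path is
  admissible because \<open>nhds x\<close> is not punctured.\<close>

lemma dir_deriv_le_clarke_deriv:
  assumes "has_dir_deriv f x h d"
  shows "d \<le> clarke_deriv f x h"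
proof (rule ccontr)
  assume "\<not> d \<le> clarke_deriv f x h"
  then obtain a where a: "clarke_deriv f x h < a" "a < d"
    using dense by (auto simp: not_le)
  have "\<forall>\<^sub>F p in at_right 0 \<times>\<^sub>F nhds x. (case p of (t, y) \<Rightarrow> diff_quotient f y h t) < a"
    using a(1) unfolding clarke_deriv_def by (rule Limsup_lessD)
  moreover have "filterlim (\<lambda>t. (t, x)) (at_right 0 \<times>\<^sub>F nhds x) (at_right 0)"
    by (intro filterlim_Pair filterlim_ident tendsto_const)
  ultimately have "\<forall>\<^sub>F t in at_right 0. diff_quotient f x h t < a"
    by (auto dest: eventually_compose_filterlim)
  then have "\<forall>\<^sub>F t in at_right 0. diff_quotient f x h t \<le> a"
    by (rule eventually_mono) simp
  then have "d \<le> a"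
    using assms unfolding has_dir_deriv_def by (intro tendsto_upperbound) auto
  with a(2) show False by simp
qed

lemma eventually_at_right_segment_in_open:
  fixes x h :: "'a::real_normed_vector"
  assumes "open U" "x \<in> U"
  shows "\<forall>\<^sub>F p in at_right 0 \<times>\<^sub>F nhds h. x + fst p *\<^sub>R snd p \<in> U"
proof -
  let ?F = "at_right (0::real) \<times>\<^sub>F nhds h"
  have "(fst \<longlongrightarrow> 0) ?F"
    by (rule filterlim_mono[OF filterlim_fst _ order_refl]) (simp add: at_within_def)
  moreover have "(snd \<longlongrightarrow> h) ?F" by (rule filterlim_snd)
  ultimately have "((\<lambda>p. x + fst p *\<^sub>R snd p) \<longlongrightarrow> x + 0 *\<^sub>R h) ?F"
    by (intro tendsto_intros)
  from topological_tendstoD[OF this assms(1)] show ?thesis using assms(2) by simp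
qed

text \<open>The value \<open>f x\<close> cancels, and the two remaining points of \<open>U\<close>
  lie at distance \<open>t * norm (u - h)\<close>, so the factor \<open>t\<close> cancels as
  well.\<close>

lemma diff_quotient_lipschitz:
  assumes "L-lipschitz_on U f" "x + t *\<^sub>R u \<in> U" "x + t *\<^sub>R h \<in> U" "t > 0"
  shows "\<bar>(f (x + t *\<^sub>R u) - f x) / t - (f (x + t *\<^sub>R h) - f x) / t\<bar> \<le> L * norm (u - h)"
proof -
  have "\<bar>f (x + t *\<^sub>R u) - f (x + t *\<^sub>R h)\<bar> \<le> L * dist (x + t *\<^sub>R u) (x + t *\<^sub>R h)"
    using lipschitz_onD[OF assms(1-3)] by (simp add: dist_real_def)
  also have "\<dots> = t * (L * norm (u - h))"
    using assms(4) by (simp add: dist_norm flip: scaleR_diff_right)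
  finally have "\<bar>f (x + t *\<^sub>R u) - f (x + t *\<^sub>R h)\<bar> / t \<le> L * norm (u - h)"
    using assms(4) by (simp add: field_simps)
  moreover have "(f (x + t *\<^sub>R u) - f x) / t - (f (x + t *\<^sub>R h) - f x) / t
      = (f (x + t *\<^sub>R u) - f (x + t *\<^sub>R h)) / t"
    by (simp add: diff_divide_distrib)
  ultimately show ?thesis using assms(4) by (simp add: abs_divide)
qed

text \<open>Replacing the moving direction \<open>u\<close> by \<open>h\<close> costs at most
  \<open>L * norm (u - h)\<close>, which tends to 0. Hence the quotient has a full joint limit in
  \<open>(t, u)\<close>, and the liminf equals it.\<close>

lemma subderiv_eq_dir_deriv:
  assumes lip: "L-lipschitz_on U f" and U: "open U" "x \<in> U"
    and d: "has_dir_deriv f x h (ereal d)"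
  shows "subderiv f x h = ereal d"
proof -
  let ?F = "at_right (0::real) \<times>\<^sub>F nhds h"
  let ?q = "\<lambda>u t. (f (x + t *\<^sub>R u) - f x) / t"
  have q: "((\<lambda>p. ?q h (fst p)) \<longlongrightarrow> d) ?F"
    using d unfolding has_dir_deriv_def diff_quotient_def
    by (auto intro: filterlim_compose[OF _ filterlim_fst])
  have "\<forall>\<^sub>F p in ?F. fst p > (0::real)"
    by (rule eventually_compose_filterlim[OF eventually_at_right_less filterlim_fst])
  moreover have "\<forall>\<^sub>F p in ?F. x + fst p *\<^sub>R snd p \<in> U"
    by (rule eventually_at_right_segment_in_open[OF U])
  moreover have "\<forall>\<^sub>F p in ?F. x + fst p *\<^sub>R h \<in> U"
  proof -
    \<comment> \<open>The path with frozen direction \<open>h\<close> turns the joint statement into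
      one about \<open>h\<close> alone.\<close>
    have "filterlim (\<lambda>p. (fst p, h)) ?F ?F"
      by (intro filterlim_Pair filterlim_fst tendsto_const)
    from eventually_compose_filterlim[OF eventually_at_right_segment_in_open[OF U] this]
    show ?thesis by simp
  qed
  ultimately have "\<forall>\<^sub>F p in ?F. norm (?q (snd p) (fst p) - ?q h (fst p)) \<le> L * norm (snd p - h)"
    by eventually_elim (simp add: diff_quotient_lipschitz[OF lip])
  moreover have "((\<lambda>p. L * norm (snd p - h)) \<longlongrightarrow> 0) ?F"
  proof -
    have "(snd \<longlongrightarrow> h) ?F" by (rule filterlim_snd)
    then have "((\<lambda>p. L * norm (snd p - h)) \<longlongrightarrow> L * norm (h - h)) ?F"
      by (intro tendsto_intros)
    then show ?thesis by simp
  qed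
  ultimately have "((\<lambda>p. ?q (snd p) (fst p) - ?q h (fst p)) \<longlongrightarrow> 0) ?F"
    by (rule Lim_null_comparison)
  from tendsto_add[OF this q] have "((\<lambda>p. ?q (snd p) (fst p)) \<longlongrightarrow> d) ?F" by simp
  then have "((\<lambda>(t, u). diff_quotient f x u t) \<longlongrightarrow> ereal d) ?F"
    by (simp add: diff_quotient_def case_prod_beta')
  then show ?thesis
    unfolding subderiv_def by (intro lim_imp_Liminf nontrivial_at_right_times_nhds)
qed

text \<open>The local constant \<open>L\<close> serves for arbitrarily long directions, since
  \<open>x + t *\<^sub>R v\<close> enters \<open>U\<close> once \<open>t\<close> is small.\<close>

lemma dir_deriv_lipschitz:
  assumes lip: "L-lipschitz_on U f" and U: "open U" "x \<in> U"
    and d: "has_dir_deriv f x h (ereal d)" and e: "has_dir_deriv f x u (ereal e)"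
  shows "\<bar>e - d\<bar> \<le> L * norm (u - h)"
proof -
  have ev: "\<forall>\<^sub>F t in at_right (0::real). x + t *\<^sub>R v \<in> U" for v
  proof -
    have "filterlim (\<lambda>t. (t, v)) (at_right (0::real) \<times>\<^sub>F nhds v) (at_right 0)"
      by (intro filterlim_Pair filterlim_ident tendsto_const)
    from eventually_compose_filterlim[OF eventually_at_right_segment_in_open[OF U] this]
    show ?thesis by simp
  qed
  let ?q = "\<lambda>v t. (f (x + t *\<^sub>R v) - f x) / t"
  have "((\<lambda>t. \<bar>?q u t - ?q h t\<bar>) \<longlongrightarrow> \<bar>e - d\<bar>) (at_right 0)"
    using d e unfolding has_dir_deriv_def diff_quotient_def by (auto intro!: tendsto_intros)
  moreover have "\<forall>\<^sub>F t in at_right 0. \<bar>?q u t - ?q h t\<bar> \<le> L * norm (u - h)"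
    using ev[of u] ev[of h] eventually_at_right_less[of "0::real"]
    by eventually_elim (simp add: diff_quotient_lipschitz[OF lip])
  ultimately show ?thesis by (intro tendsto_upperbound) auto
qed

text \<open>The pair is \<open>1 / t\<close> times the displacement from \<open>(x, f x)\<close> to
  the graph point over \<open>x + t *\<^sub>R h\<close>. Both upper bounds on the radial
  epiderivative come from it, with \<open>t = 1\<close> and with \<open>t\<close> tending to
  0.\<close>

lemma difference_quotient_in_radial_cone:
  assumes "t > 0"
  shows "(h, (f (x + t *\<^sub>R h) - f x) / t) \<in> radial_cone (epigraph UNIV f) (x, f x)"
proof -
  have "(h, (f (x + t *\<^sub>R h) - f x) / t) = (1 / t) *\<^sub>R ((x + t *\<^sub>R h, f (x + t *\<^sub>R h)) - (x, f x))"
    using assms by simp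
  moreover have "(x + t *\<^sub>R h, f (x + t *\<^sub>R h)) \<in> epigraph UNIV f" by (simp add: mem_epigraph)
  moreover have "1 / t \<ge> 0" using assms by simp
  ultimately have "(h, (f (x + t *\<^sub>R h) - f x) / t)
      \<in> cone hull ((\<lambda>p. p - (x, f x)) ` epigraph UNIV f)"
    unfolding cone_hull_expl by blast
  then show ?thesis unfolding radial_cone_def using closure_subset by blast
qed

lemma radial_epideriv_le_difference: "radial_epideriv f x h \<le> ereal (f (x + h) - f x)"
  using difference_quotient_in_radial_cone[of 1 h f x] by (simp add: radial_epideriv_le_iff)

lemma radial_epideriv_le_dir_deriv:
  assumes "has_dir_deriv f x h (ereal d)"
  shows "radial_epideriv f x h \<le> ereal d"
proof -
  have "((\<lambda>t. (h, (f (x + t *\<^sub>R h) - f x) / t)) \<longlongrightarrow> (h, d)) (at_right 0)"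
    using assms unfolding has_dir_deriv_def diff_quotient_def by (auto intro!: tendsto_intros)
  moreover have "\<forall>\<^sub>F t in at_right 0.
      (h, (f (x + t *\<^sub>R h) - f x) / t) \<in> radial_cone (epigraph UNIV f) (x, f x)"
    using eventually_at_right_less[of "0::real"]
    by eventually_elim (rule difference_quotient_in_radial_cone)
  ultimately show ?thesis unfolding radial_epideriv_le_iff
    by (intro Lim_in_closed_set[of "radial_cone _ _"]) (auto simp: radial_cone_def)
qed

lemma le_radial_epideriv:
  fixes D :: "'a::real_normed_vector \<Rightarrow> real"
  assumes hom: "\<And>c v. c > 0 \<Longrightarrow> D (c *\<^sub>R v) = c * D v"
    and lip: "\<And>u v. \<bar>D u - D v\<bar> \<le> L * norm (u - v)"
    and le: "\<And>v. D v \<le> f (x + v) - f x"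
  shows "ereal (D h) \<le> radial_epideriv f x h"
  unfolding radial_epideriv_def
proof (rule INF_greatest, clarsimp)
  fix y assume "(h, y) \<in> radial_cone (epigraph UNIV f) (x, f x)"
  then obtain l b where lb: "\<And>n::nat. l n > 0 \<and> b n \<in> epigraph UNIV f"
      "(\<lambda>n. l n *\<^sub>R (b n - (x, f x))) \<longlonglongrightarrow> (h, y)"
    by (auto simp: radial_cone_sequential mem_epigraph)
  \<comment> \<open>The two components of the approximating cone elements, with limits
    \<open>h\<close> and \<open>y\<close>.\<close>
  define u r where "u n = l n *\<^sub>R (fst (b n) - x)" and "r n = l n * (snd (b n) - f x)" for n
  have u: "u \<longlonglongrightarrow> h" and r: "r \<longlonglongrightarrow> y"
    using tendsto_fst[OF lb(2)] tendsto_snd[OF lb(2)] by (simp_all add: u_def[abs_def] r_def[abs_def])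
  \<comment> \<open>Homogeneity carries the minorant through the factor \<open>l n\<close>, giving
    \<open>D (u n) \<le> r n\<close>. The Lipschitz bound then exchanges \<open>u n\<close> for the
    limit direction \<open>h\<close>, with an error that vanishes.\<close>
  have "D h - L * norm (u n - h) \<le> r n" for n
  proof -
    have "f (fst (b n)) \<le> snd (b n)"
      using lb(1)[of n] by (simp add: epigraph_def)
    then have "D (fst (b n) - x) \<le> snd (b n) - f x"
      using le[of "fst (b n) - x"] by simp
    then have "D (u n) \<le> r n"
      unfolding u_def r_def using lb(1)[of n] by (simp add: hom)
    then show ?thesis using lip[of "u n" h] by linarith
  qed
  moreover have "(\<lambda>n. D h - L * norm (u n - h)) \<longlonglongrightarrow> D h - L * norm (h - h)"
    by (intro tendsto_intros u)
  ultimately show "D h \<le> y" using r by (auto intro: LIMSEQ_le)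
qed

theorem theorem8:
  fixes f :: "'a::real_normed_vector \<Rightarrow> real" and xbar :: 'a
  assumes loc_lipschitz: "\<exists>L U. open U \<and> xbar \<in> U \<and> L-lipschitz_on U f"
    and dir: "\<And>x. \<exists>d. has_dir_deriv f xbar (x - xbar) d \<and> \<bar>d\<bar> \<noteq> \<infinity>"
    and clarke: "\<And>x. \<bar>clarke_deriv f xbar (x - xbar)\<bar> \<noteq> \<infinity>"
    and sub: "\<And>x. \<bar>subderiv f xbar (x - xbar)\<bar> \<noteq> \<infinity>"
  shows "(radially_epidifferentiable f xbar \<and>
          (\<forall>x. radial_epideriv f xbar (x - xbar) = subderiv f xbar (x - xbar) \<and>
               subderiv f xbar (x - xbar) = dir_deriv f xbar (x - xbar) \<and>
               dir_deriv f xbar (x - xbar) = clarke_deriv f xbar (x - xbar))) \<longleftrightarrow>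
         (\<forall>x. ereal (f x - f xbar) \<ge> clarke_deriv f xbar (x - xbar))"
proof -
  obtain L U where U: "open U" "xbar \<in> U" and lip: "L-lipschitz_on U f"
    using loc_lipschitz by blast
  have "\<exists>d. has_dir_deriv f xbar h (ereal d)" for h
    using dir[of "xbar + h"] by auto
  then obtain D where D: "\<And>h. has_dir_deriv f xbar h (ereal (D h))" by metis
  have dir_eq: "dir_deriv f xbar h = ereal (D h)" for h
    using dir_deriv_eq[OF D] .
  have sub_eq: "subderiv f xbar h = ereal (D h)" for h
    using subderiv_eq_dir_deriv[OF lip U D] .
  show ?thesis (is "?equal \<longleftrightarrow> ?minorant")
  proof
    assume ?equal
    then have "clarke_deriv f xbar (x - xbar) = radial_epideriv f xbar (x - xbar)" for x
      by metis
    then show ?minorant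
      using radial_epideriv_le_difference[of f xbar "x - xbar" for x] by simp
  next
    assume ?minorant
    then have le: "clarke_deriv f xbar h \<le> ereal (f (xbar + h) - f xbar)" for h
      by (metis add_diff_cancel_left')
    have clarke_eq: "clarke_deriv f xbar h = ereal (D h)" for h
    proof (rule antisym)
      show "ereal (D h) \<le> clarke_deriv f xbar h"
        using dir_deriv_le_clarke_deriv[OF D] .
      obtain c where c: "clarke_deriv f xbar h = ereal c"
        using clarke[of "xbar + h"] by auto
      \<comment> \<open>The minorant inequality in direction \<open>t *\<^sub>R h\<close>, divided
        by \<open>t\<close>: homogeneity puts \<open>c\<close> below every quotient, hence below
        their limit \<open>D h\<close>.\<close>
      have "ereal c \<le> diff_quotient f xbar h t" if "t > 0" for t
        using le[of "t *\<^sub>R h"] that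
        by (simp add: clarke_deriv_scaleR c diff_quotient_def field_simps)
      then have "\<forall>\<^sub>F t in at_right 0. ereal c \<le> diff_quotient f xbar h t"
        using eventually_at_right_less[of "0::real"] by (auto elim: eventually_mono)
      then show "clarke_deriv f xbar h \<le> ereal (D h)"
        using D[of h] unfolding c has_dir_deriv_def by (intro tendsto_lowerbound) auto
    qed
    \<comment> \<open>Homogeneity of \<open>D\<close> is read off from the Clarke derivative, with
      which it now coincides.\<close>
    have "D (c *\<^sub>R v) = c * D v" if "c > 0" for c v
      using clarke_deriv_scaleR[OF that, of f xbar v] by (simp add: clarke_eq)
    then have "ereal (D h) \<le> radial_epideriv f xbar h" for h
      using dir_deriv_lipschitz[OF lip U D D] le
      by (intro le_radial_epideriv[where L = L]) (auto simp: clarke_eq)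
    then have "radial_epideriv f xbar h = ereal (D h)" for h
      using radial_epideriv_le_dir_deriv[OF D] by (intro antisym)
    then show ?equal
      by (simp add: radially_epidifferentiable_def sub_eq dir_eq clarke_eq)
  qed
qed

end
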